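(* If $X$ and $Y$ are two separable almost Daugavet spaces, then $X\oplus_\infty Y$ is an almost Daugavet space as well.
   Context: Banach spaces are over the scalar field $\mathbb{K}\in\{\mathbb{R},\mathbb{C}\}$. $X\oplus_\infty Y$ denotes the direct sum $X\times Y$ with the norm $\|(x,y)\|=\max\{\|x\|,\|y\|\}$. For a Banach space $X$, $X^*$ denotes its dual, and $S_W$ denotes the unit sphere of a normed space $W$. A linear subspace $W\subset X^*$ is called norming if $\sup_{w^*\in S_W}|w^*(x)|=\|x\|$ for every $x\in X$. For $x\in X$ and $w^*\in X^*$, $w^*\otimes x$ denotes the operator $X\to X$, $z\mapsto w^*(z)x$. $X$ has the Daugavet property with respect to a subspace $W\subset X^*$ if $\|\operatorname{Id}+T\|=1+\|T\|$ holds for every operator $T=w^*\otimes x$ with $x\in X$ and $w^*\in W$ (the zero operator is included here, so the space $\{0\}$ does not qualify; for nonzero spaces including it makes no difference). $X$ is called an almost Daugavet space if it has the Daugavet property with respect to some norming subspace $W\subset X^*$. *)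

theory Defs
  imports "HOL-Analysis.Analysis"
begin

text \<open>
  Scalar fields that are isometrically isomorphic to the reals or to the complex numbers.
  The term \<open>r *\<^sub>R 1\<close> is \<^term>\<open>of_real r\<close>, which cannot be mentioned in a class assumption.
\<close>

class real_or_complex = real_normed_field +
  assumes real_or_complex:
    "surj (\<lambda>r. r *\<^sub>R 1) \<or>
     (\<exists>\<phi> :: complex \<Rightarrow> 'a. bij \<phi> \<and> (\<forall>z w. \<phi> (z + w) = \<phi> z + \<phi> w) \<and>
        (\<forall>z w. \<phi> (z * w) = \<phi> z * \<phi> w) \<and> (\<forall>r. \<phi> (complex_of_real r) = r *\<^sub>R 1) \<and>
        (\<forall>z. norm (\<phi> z) = norm z))"

instance real :: real_or_complex
proof
  have "surj (\<lambda>r. r *\<^sub>R (1::real))"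
    by (rule surjI[of _ id]) simp
  then show "surj (\<lambda>r. r *\<^sub>R (1::real)) \<or>
     (\<exists>\<phi> :: complex \<Rightarrow> real. bij \<phi> \<and> (\<forall>z w. \<phi> (z + w) = \<phi> z + \<phi> w) \<and>
        (\<forall>z w. \<phi> (z * w) = \<phi> z * \<phi> w) \<and> (\<forall>r. \<phi> (complex_of_real r) = r *\<^sub>R 1) \<and>
        (\<forall>z. norm (\<phi> z) = norm z))" ..
qed

instance complex :: real_or_complex
proof
  show "surj (\<lambda>r. r *\<^sub>R (1::complex)) \<or>
     (\<exists>\<phi> :: complex \<Rightarrow> complex. bij \<phi> \<and> (\<forall>z w. \<phi> (z + w) = \<phi> z + \<phi> w) \<and>
        (\<forall>z w. \<phi> (z * w) = \<phi> z * \<phi> w) \<and> (\<forall>r. \<phi> (complex_of_real r) = r *\<^sub>R 1) \<and>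
        (\<forall>z. norm (\<phi> z) = norm z))"
    by (rule disjI2, rule exI[of _ id]) (auto simp: scaleR_conv_of_real)
qed

text \<open>
  A Banach space over \<open>'k\<close> is a type of class \<^class>\<open>banach\<close> together with a scalar multiplication
  by \<open>'k\<close> that extends the real one and for which the norm is homogeneous.
\<close>

locale banach_space_over = vector_space smul
  for smul :: "'k::real_or_complex \<Rightarrow> 'a::banach \<Rightarrow> 'a" +
  assumes scale_of_real: "smul (of_real r) x = r *\<^sub>R x"
    and norm_scale: "norm (smul c x) = norm c * norm x"

lemma banach_space_over_scaleR: "banach_space_over (scaleR :: real \<Rightarrow> 'a::banach \<Rightarrow> 'a)"
  by unfold_locales (auto simp: algebra_simps)

lemma banach_space_over_times:
  "banach_space_over ((*) :: 'k \<Rightarrow> 'k \<Rightarrow> 'k::{real_or_complex, banach})"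
  by unfold_locales (auto simp: algebra_simps norm_mult scaleR_conv_of_real)

definition dual_space :: "('k::real_or_complex \<Rightarrow> 'a::banach \<Rightarrow> 'a) \<Rightarrow> ('a \<Rightarrow> 'k) set" where
  "dual_space smul = {f. bounded_linear f \<and> (\<forall>c x. f (smul c x) = c * f x)}"

definition dual_subspace :: "('k::real_or_complex \<Rightarrow> 'a::banach \<Rightarrow> 'a) \<Rightarrow> ('a \<Rightarrow> 'k) set \<Rightarrow> bool" where
  "dual_subspace smul W \<longleftrightarrow>
     W \<subseteq> dual_space smul \<and> (\<lambda>x. 0) \<in> W \<and>
     (\<forall>f\<in>W. \<forall>g\<in>W. (\<lambda>x. f x + g x) \<in> W) \<and> (\<forall>c. \<forall>f\<in>W. (\<lambda>x. c * f x) \<in> W)"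

text \<open>
  For \<open>W = {0}\<close> the supremum ranges over the empty set and is an unspecified constant. This is
  harmless: on a nonzero space such a \<open>W\<close> is not norming whatever the constant is, and the zero
  space does not have the Daugavet property with respect to any subspace.
\<close>

definition norming :: "('a::banach \<Rightarrow> 'k::real_or_complex) set \<Rightarrow> bool" where
  "norming W \<longleftrightarrow> (\<forall>x. (SUP w \<in> {w \<in> W. onorm w = 1}. norm (w x)) = norm x)"

definition rank_one ::
    "('k::real_or_complex \<Rightarrow> 'a::banach \<Rightarrow> 'a) \<Rightarrow> ('a \<Rightarrow> 'k) \<Rightarrow> 'a \<Rightarrow> 'a \<Rightarrow> 'a" where
  "rank_one smul w x = (\<lambda>z. smul (w z) x)"

definition daugavet_wrt ::
    "('k::real_or_complex \<Rightarrow> 'a::banach \<Rightarrow> 'a) \<Rightarrow> ('a \<Rightarrow> 'k) set \<Rightarrow> bool" where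
  "daugavet_wrt smul W \<longleftrightarrow>
     (\<forall>x. \<forall>w\<in>W. onorm (\<lambda>z. z + rank_one smul w x z) = 1 + onorm (rank_one smul w x))"

definition almost_daugavet :: "('k::real_or_complex \<Rightarrow> 'a::banach \<Rightarrow> 'a) \<Rightarrow> bool" where
  "almost_daugavet smul \<longleftrightarrow>
     banach_space_over smul \<and>
     (\<exists>W. dual_subspace smul W \<and> norming W \<and> daugavet_wrt smul W)"

text \<open>
  The product type of the library carries the Euclidean norm, so the direct sum with the
  maximum norm is a type of its own.
\<close>

typedef ('a, 'b) max_sum = "UNIV :: ('a \<times> 'b) set"
  morphisms pair_of of_pair ..

setup_lifting type_definition_max_sum

instantiation max_sum :: (real_normed_vector, real_normed_vector) real_normed_vector
begin

lift_definition zero_max_sum :: "('a, 'b) max_sum" is "(0, 0)" .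
lift_definition plus_max_sum :: "('a, 'b) max_sum \<Rightarrow> ('a, 'b) max_sum \<Rightarrow> ('a, 'b) max_sum"
  is "\<lambda>p q. (fst p + fst q, snd p + snd q)" .
lift_definition minus_max_sum :: "('a, 'b) max_sum \<Rightarrow> ('a, 'b) max_sum \<Rightarrow> ('a, 'b) max_sum"
  is "\<lambda>p q. (fst p - fst q, snd p - snd q)" .
lift_definition uminus_max_sum :: "('a, 'b) max_sum \<Rightarrow> ('a, 'b) max_sum"
  is "\<lambda>p. (- fst p, - snd p)" .
lift_definition scaleR_max_sum :: "real \<Rightarrow> ('a, 'b) max_sum \<Rightarrow> ('a, 'b) max_sum"
  is "\<lambda>r p. (r *\<^sub>R fst p, r *\<^sub>R snd p)" .
lift_definition norm_max_sum :: "('a, 'b) max_sum \<Rightarrow> real"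
  is "\<lambda>p. max (norm (fst p)) (norm (snd p))" .

definition dist_max_sum :: "('a, 'b) max_sum \<Rightarrow> ('a, 'b) max_sum \<Rightarrow> real" where
  "dist_max_sum p q = norm (p - q)"
definition sgn_max_sum :: "('a, 'b) max_sum \<Rightarrow> ('a, 'b) max_sum" where
  "sgn_max_sum p = inverse (norm p) *\<^sub>R p"
definition uniformity_max_sum :: "(('a, 'b) max_sum \<times> ('a, 'b) max_sum) filter" where
  "uniformity_max_sum = (INF e\<in>{0 <..}. principal {(p, q). dist p q < e})"
definition open_max_sum :: "('a, 'b) max_sum set \<Rightarrow> bool" where
  "open_max_sum U \<longleftrightarrow> (\<forall>p\<in>U. eventually (\<lambda>(p', q). p' = p \<longrightarrow> q \<in> U) uniformity)"

instance
proof
  fix p q r :: "('a, 'b) max_sum" and a b :: real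
  show "p + q + r = p + (q + r)" "p + q = q + p" "0 + p = p" "- p + p = 0" "p - q = p + - q"
    by (transfer, simp add: algebra_simps)+
  show "a *\<^sub>R (p + q) = a *\<^sub>R p + a *\<^sub>R q" "(a + b) *\<^sub>R p = a *\<^sub>R p + b *\<^sub>R p"
    "a *\<^sub>R b *\<^sub>R p = (a * b) *\<^sub>R p" "1 *\<^sub>R p = p"
    by (transfer, simp add: algebra_simps)+
  show "(norm p = 0) = (p = 0)"
    by transfer (auto simp: max_def split: if_splits intro: prod_eqI)
  show "norm (p + q) \<le> norm p + norm q"
    by transfer (auto intro: norm_triangle_le add_mono)
  show "norm (a *\<^sub>R p) = \<bar>a\<bar> * norm p"
    by transfer (simp add: max_mult_distrib_left)
qed (rule dist_max_sum_def sgn_max_sum_def uniformity_max_sum_def open_max_sum_def)+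

end

instance max_sum :: (banach, banach) banach
proof
  fix X :: "nat \<Rightarrow> ('a, 'b) max_sum"
  assume X: "Cauchy X"
  define f where "f = (\<lambda>n. fst (pair_of (X n)))"
  define g where "g = (\<lambda>n. snd (pair_of (X n)))"
  have dist_eq: "dist p q = max (dist (fst (pair_of p)) (fst (pair_of q)))
      (dist (snd (pair_of p)) (snd (pair_of q)))" for p q :: "('a, 'b) max_sum"
    unfolding dist_norm by transfer simp
  have "Cauchy f" "Cauchy g"
    using X unfolding Cauchy_def f_def g_def dist_eq by (meson max_less_iff_conj)+
  then obtain a b where ab: "f \<longlonglongrightarrow> a" "g \<longlonglongrightarrow> b"
    by (meson Cauchy_convergent convergent_def)
  have "X \<longlonglongrightarrow> of_pair (a, b)"
    unfolding tendsto_iff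
  proof (intro allI impI)
    fix e :: real
    assume "e > 0"
    then have "\<forall>\<^sub>F n in sequentially. dist (f n) a < e" "\<forall>\<^sub>F n in sequentially. dist (g n) b < e"
      using ab by (auto simp: tendsto_iff)
    then show "\<forall>\<^sub>F n in sequentially. dist (X n) (of_pair (a, b)) < e"
      by eventually_elim (simp add: dist_eq f_def g_def of_pair_inverse)
  qed
  then show "convergent X"
    by (auto simp: convergent_def)
qed

lift_definition max_sum_scale ::
    "('k \<Rightarrow> 'a \<Rightarrow> 'a) \<Rightarrow> ('k \<Rightarrow> 'b \<Rightarrow> 'b) \<Rightarrow> 'k \<Rightarrow> ('a, 'b) max_sum \<Rightarrow> ('a, 'b) max_sum"
  is "\<lambda>sX sY c p. (sX c (fst p), sY c (snd p))" .

lemma banach_space_over_max_sum: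
  fixes sX :: "'k::real_or_complex \<Rightarrow> 'a::banach \<Rightarrow> 'a" and sY :: "'k \<Rightarrow> 'b::banach \<Rightarrow> 'b"
  assumes "banach_space_over sX" "banach_space_over sY"
  shows "banach_space_over (max_sum_scale sX sY)"
proof -
  interpret X: banach_space_over sX by fact
  interpret Y: banach_space_over sY by fact
  note rep_eqs = pair_of_inject[symmetric] max_sum_scale.rep_eq plus_max_sum.rep_eq
    scaleR_max_sum.rep_eq norm_max_sum.rep_eq
  show ?thesis
  proof
    fix c d :: 'k and r :: real and p q :: "('a, 'b) max_sum"
    let ?s = "max_sum_scale sX sY"
    show "?s c (p + q) = ?s c p + ?s c q"
      by (simp add: rep_eqs X.scale_right_distrib Y.scale_right_distrib)
    show "?s (c + d) p = ?s c p + ?s d p"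
      by (simp add: rep_eqs X.scale_left_distrib Y.scale_left_distrib)
    show "?s c (?s d p) = ?s (c * d) p"
      by (simp add: rep_eqs)
    show "?s 1 p = p"
      by (simp add: rep_eqs)
    show "?s (of_real r) p = r *\<^sub>R p"
      by (simp add: rep_eqs X.scale_of_real Y.scale_of_real)
    show "norm (?s c p) = norm c * norm p"
      by (simp add: rep_eqs X.norm_scale Y.norm_scale max_mult_distrib_left)
  qed
qed

end

theory Submission
  imports Defs
begin

text \<open>
  Let \<open>U\<close> and \<open>V\<close> be norming subspaces of \<open>X\<^sup>*\<close> and \<open>Y\<^sup>*\<close> that witness the almost Daugavet
  property. The functionals \<open>(x, y) \<mapsto> f x + g y\<close> with \<open>f \<in> U\<close> and \<open>g \<in> V\<close> form a subspace
  of \<open>(X \<oplus>\<^sub>\<infinity> Y)\<^sup>*\<close> that witnesses it for the sum.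

  It is norming because the functionals with \<open>g = 0\<close> already recover \<open>\<parallel>x\<parallel>\<close> and those with
  \<open>f = 0\<close> recover \<open>\<parallel>y\<parallel>\<close>. For the Daugavet equation the geometric form of the property is
  used (lemmas \<open>daugavet_wrt_imp_slices\<close> and \<open>slices_imp_daugavet_wrt\<close>): for every functional \<open>w\<close> in the subspace and every unit
  vector \<open>x\<close>, some \<open>u\<close> in the unit ball has \<open>w u\<close> nearly equal to \<open>\<parallel>w\<parallel>\<close> and \<open>\<parallel>u + x\<parallel>\<close> nearly
  equal to 2. This form passes to the maximum sum one coordinate at a time. If \<open>\<parallel>(x, y)\<parallel> = 1\<close>, then
  one of the coordinates, say \<open>x\<close>, is a unit vector. Take such a \<open>u\<close> for \<open>f\<close> and \<open>x\<close>, and take any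
  \<open>v\<close> in the unit ball of \<open>Y\<close> where \<open>g\<close> nearly attains its norm. Then \<open>(u, v)\<close> is in the unit ball of
  the sum, \<open>f u + g v\<close> is nearly \<open>\<parallel>f\<parallel> + \<parallel>g\<parallel>\<close>, which bounds the norm of the functional, and the
  distance of \<open>(u, v)\<close> from \<open>-(x, y)\<close> is at least \<open>\<parallel>u + x\<parallel>\<close>.
\<close>

section \<open>Functionals and rank-one operators\<close>

lemma onorm_almost_attained:
  fixes T :: "'a::real_normed_vector \<Rightarrow> 'b::real_normed_vector"
  assumes T: "bounded_linear T" and e: "e > 0"
  shows "\<exists>u. norm u \<le> 1 \<and> norm (T u) > onorm T - e"
proof (rule ccontr)
  assume "\<not> ?thesis"
  then have small: "norm (T u) \<le> onorm T - e" if "norm u \<le> 1" for u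
    using that by force
  interpret T: bounded_linear T by fact
  have nonneg: "0 \<le> onorm T - e"
    using small[of 0] by (simp add: T.zero)
  have "norm (T x) \<le> (onorm T - e) * norm x" for x
  proof (cases "x = 0")
    case False
    then have "norm (T (x /\<^sub>R norm x)) \<le> onorm T - e"
      by (intro small) simp
    then show ?thesis
      using False by (simp add: T.scaleR field_simps)
  qed (simp add: T.zero)
  then have "onorm T \<le> onorm T - e"
    by (intro onorm_bound nonneg)
  then show False
    using e by simp
qed

lemma onorm_identity:
  assumes "(x::'a::real_normed_vector) \<noteq> 0"
  shows "onorm (\<lambda>z::'a. z) = 1"
proof (rule antisym)
  show "onorm (\<lambda>z::'a. z) \<le> 1"
    by (rule onorm_bound) auto
  have "norm x \<le> onorm (\<lambda>z::'a. z) * norm x"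
    using onorm[OF bounded_linear_ident, of x] by simp
  then show "1 \<le> onorm (\<lambda>z::'a. z)"
    using assms by simp
qed

lemma onorm_trivial_domain:
  assumes "\<forall>x::'a::real_normed_vector. x = 0"
    and "bounded_linear (T :: 'a \<Rightarrow> 'b::real_normed_vector)"
  shows "onorm T = 0"
proof -
  have "T x = 0" for x
    using assms(1)[rule_format, of x] bounded_linear.linear[OF assms(2)] by (simp add: linear_0)
  then show ?thesis
    using onorm_eq_0[OF assms(2)] by simp
qed

lemma dual_spaceD:
  assumes "f \<in> dual_space s"
  shows "bounded_linear f" "f (s c x) = c * f x"
  using assms by (auto simp: dual_space_def)

lemma dual_subspaceD:
  assumes "dual_subspace s W"
  shows "(\<lambda>x. 0) \<in> W"
    and "f \<in> W \<Longrightarrow> f \<in> dual_space s"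
    and "f \<in> W \<Longrightarrow> g \<in> W \<Longrightarrow> (\<lambda>x. f x + g x) \<in> W"
    and "f \<in> W \<Longrightarrow> (\<lambda>x. c * f x) \<in> W"
  using assms by (auto simp: dual_subspace_def)

text \<open>
  Multiplying \<open>u\<close> by a scalar of modulus 1 makes \<open>w u\<close> a nonnegative real. Rank-one operators commute
  with such a rotation, so it does not change the norm of \<open>u + a w(u) x\<close>.
\<close>

lemma (in banach_space_over) rotate_to_nonneg:
  assumes w: "w \<in> dual_space smul"
  shows "\<exists>u'. norm u' = norm u \<and> w u' = of_real (norm (w u)) \<and>
    (\<forall>x. norm (u' + smul (w u') x) = norm (u + smul (w u) x))"
proof (cases "w u = 0")
  case True
  then show ?thesis
    by (intro exI[of _ u]) simp
next
  case False
  define c where "c = of_real (norm (w u)) / w u"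
  have c: "norm c = 1" "c * w u = of_real (norm (w u))"
    using False by (simp_all add: c_def norm_divide)
  have "norm (smul c u + smul (w (smul c u)) x) = norm (u + smul (w u) x)" for x
  proof -
    have "smul c u + smul (w (smul c u)) x = smul c (u + smul (w u) x)"
      by (simp add: dual_spaceD(2)[OF w] scale_right_distrib)
    then show ?thesis
      by (simp add: norm_scale c)
  qed
  then show ?thesis
    by (intro exI[of _ "smul c u"]) (simp add: norm_scale c dual_spaceD(2)[OF w])
qed

lemma (in banach_space_over) slice_nonempty:
  assumes w: "w \<in> dual_space smul" and e: "e > 0"
  shows "\<exists>u t. norm u \<le> 1 \<and> w u = of_real t \<and> t \<ge> onorm w - e"
proof -
  obtain u where u: "norm u \<le> 1" "norm (w u) > onorm w - e"
    using onorm_almost_attained[OF dual_spaceD(1)[OF w] e] by blast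
  obtain u' where "norm u' = norm u" "w u' = of_real (norm (w u))"
    using rotate_to_nonneg[OF w, of u] by blast
  then show ?thesis
    using u by (metis less_imp_le)
qed

lemma (in banach_space_over) bounded_linear_rank_one:
  assumes w: "w \<in> dual_space smul"
  shows "bounded_linear (rank_one smul w x)"
proof -
  interpret w: bounded_linear w by (rule dual_spaceD(1)[OF w])
  show ?thesis
  proof (rule bounded_linear_intro[of _ "onorm w * norm x"])
    fix y z :: 'a and r :: real
    show "rank_one smul w x (y + z) = rank_one smul w x y + rank_one smul w x z"
      by (simp add: rank_one_def w.add scale_left_distrib)
    have "smul (of_real r * w y) x = r *\<^sub>R smul (w y) x"
      by (simp add: scale_of_real flip: scale_scale)
    then show "rank_one smul w x (r *\<^sub>R y) = r *\<^sub>R rank_one smul w x y"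
      by (simp add: rank_one_def w.scaleR scaleR_conv_of_real)
    have "norm (w y) * norm x \<le> onorm w * norm y * norm x"
      by (intro mult_right_mono onorm[OF w.bounded_linear_axioms]) simp
    then show "norm (rank_one smul w x y) \<le> norm y * (onorm w * norm x)"
      by (simp add: rank_one_def norm_scale mult_ac)
  qed
qed

lemma (in banach_space_over) onorm_rank_one:
  assumes w: "w \<in> dual_space smul"
  shows "onorm (rank_one smul w x) = onorm w * norm x"
proof -
  note bl = dual_spaceD(1)[OF w]
  have "onorm (\<lambda>z. norm x *\<^sub>R w z) = norm x * onorm w"
    using onorm_scaleR[OF bl, of "norm x"] by simp
  moreover have "onorm (rank_one smul w x) = onorm (\<lambda>z. norm x *\<^sub>R w z)"
    by (simp add: onorm_def rank_one_def norm_scale mult.commute)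
  ultimately show ?thesis
    by simp
qed

section \<open>The Daugavet property in terms of slices\<close>

text \<open>
  The set of all \<open>u\<close> in the unit ball with \<open>w u\<close> near \<open>\<parallel>w\<parallel>\<close> is a slice of the ball. The condition says
  that no unit vector is at distance much less than 2 from all points of such a slice.
\<close>

definition daugavet_slices ::
    "('a::banach \<Rightarrow> 'k::real_or_complex) set \<Rightarrow> bool" where
  "daugavet_slices W \<longleftrightarrow>
     (\<forall>w\<in>W. \<forall>x. norm x = 1 \<longrightarrow> (\<forall>e>0. \<exists>u t.
        norm u \<le> 1 \<and> w u = of_real t \<and> t \<ge> onorm w - e \<and> norm (u + x) \<ge> 2 - e))"

text \<open>
  Since \<open>\<parallel>Id + T\<parallel> = 2\<close> for \<open>T = (w / \<parallel>w\<parallel>) \<otimes> x\<close>, some \<open>u\<close> in the ball makes \<open>u + T u\<close> nearly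
  of norm 2. This forces \<open>\<bar>w u\<bar>\<close> to be nearly \<open>\<parallel>w\<parallel>\<close>, and after a rotation of \<open>u\<close> the vector \<open>T u\<close>
  is nearly \<open>x\<close>.
\<close>

lemma (in banach_space_over) daugavet_wrt_imp_slice_nonzero:
  assumes W: "dual_subspace smul W" and D: "daugavet_wrt smul W"
    and w: "w \<in> W" and pos: "onorm w > 0" and x: "norm x = 1" and e: "e > 0"
  shows "\<exists>u t. norm u \<le> 1 \<and> w u = of_real t \<and> t \<ge> onorm w - e \<and> norm (u + x) \<ge> 2 - e"
proof -
  note wd = dual_subspaceD(2)[OF W w]
  define N where "N = onorm w"
  have N: "N > 0"
    using pos by (simp add: N_def)
  define y where "y = x /\<^sub>R N"
  have y: "norm y = 1 / N"
    using N x by (simp add: y_def field_simps)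
  \<comment> \<open>The error bound \<open>d * N\<close> controls \<open>w u\<close>, and \<open>2 * d\<close> controls \<open>\<parallel>u + x\<parallel>\<close>.\<close>
  define d where "d = min (e / 2) (e / N)"
  have d: "d > 0" "2 * d \<le> e" "d * N \<le> e"
    using e N by (auto simp: d_def min_def field_simps)
  have "onorm (\<lambda>z. z + rank_one smul w y z) = 2"
    using D w N by (auto simp: daugavet_wrt_def onorm_rank_one[OF wd] y N_def)
  then obtain u0 where u0: "norm u0 \<le> 1" "norm (u0 + rank_one smul w y u0) > 2 - d"
    using onorm_almost_attained[OF bounded_linear_add[OF bounded_linear_ident
        bounded_linear_rank_one[OF wd, of y]] d(1)] by auto
  define t where "t = norm (w u0)"
  obtain u where u: "norm u = norm u0" "w u = of_real t"
      "norm (u + smul (w u) y) = norm (u0 + smul (w u0) y)"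
    using rotate_to_nonneg[OF wd, of u0] unfolding t_def by blast
  have near2: "norm (u + (t / N) *\<^sub>R x) > 2 - d"
    using u0(2) u(3) by (simp add: rank_one_def u(2) scale_of_real y_def field_simps)
  have "t \<le> N * norm u0"
    unfolding t_def N_def by (rule onorm[OF dual_spaceD(1)[OF wd]])
  also have "\<dots> \<le> N"
    using N u0(1) by simp
  finally have tN: "t / N \<le> 1"
    using N by simp
  have t0: "0 \<le> t / N"
    using N by (simp add: t_def)
  have "norm (u + (t / N) *\<^sub>R x) \<le> 1 + t / N"
    using norm_triangle_ineq[of u "(t / N) *\<^sub>R x"] u(1) u0(1) t0 x by simp
  then have large: "t / N > 1 - d"
    using near2 by simp
  then have "t \<ge> N - d * N"
    using N by (simp add: field_simps)
  then have "t \<ge> N - e"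
    using d(3) by simp
  moreover have "norm (u + x) \<ge> 2 - e"
  proof -
    have "u + (t / N) *\<^sub>R x = (u + x) - (1 - t / N) *\<^sub>R x"
      by (simp add: algebra_simps)
    then have "norm (u + (t / N) *\<^sub>R x) \<le> norm (u + x) + norm ((1 - t / N) *\<^sub>R x)"
      by (metis norm_triangle_ineq4)
    also have "norm ((1 - t / N) *\<^sub>R x) = 1 - t / N"
      using tN x by simp
    finally show ?thesis
      using near2 large d(2) by simp
  qed
  ultimately show ?thesis
    using u u0(1) unfolding N_def by metis
qed

text \<open>
  The slice condition for \<open>w = 0\<close> does not follow from the Daugavet equation for \<open>w\<close>, which is then
  trivial. It is inherited from any nonzero functional in \<open>W\<close>, and such a functional exists when \<open>W\<close>
  is norming on a nonzero space.
\<close>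

lemma (in banach_space_over) daugavet_wrt_imp_slices:
  assumes W: "dual_subspace smul W" and D: "daugavet_wrt smul W"
    and v: "v \<in> W" "onorm v = 1"
  shows "daugavet_slices W"
  unfolding daugavet_slices_def
proof (intro ballI allI impI)
  fix w and x :: 'a and e :: real
  assume w: "w \<in> W" and x: "norm x = 1" and e: "e > 0"
  note bl = dual_spaceD(1)[OF dual_subspaceD(2)[OF W w]]
  show "\<exists>u t. norm u \<le> 1 \<and> w u = of_real t \<and> t \<ge> onorm w - e \<and> norm (u + x) \<ge> 2 - e"
  proof (cases "onorm w > 0")
    case True
    then show ?thesis
      by (rule daugavet_wrt_imp_slice_nonzero[OF W D w _ x e])
  next
    case False
    then have "onorm w = 0"
      using onorm_pos_le[OF bl] by simp
    then have w0: "w z = of_real 0" for z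
      using onorm_eq_0[OF bl] by simp
    obtain u where "norm u \<le> 1" "norm (u + x) \<ge> 2 - e"
      using daugavet_wrt_imp_slice_nonzero[OF W D v(1) _ x e] v(2) by auto
    then show ?thesis
      using w0 \<open>onorm w = 0\<close> e by (intro exI[of _ u] exI[of _ 0]) simp
  qed
qed

text \<open>
  If \<open>\<parallel>u + x\<parallel>\<close> is nearly 2 for vectors of norm at most 1, then the triangle inequality is nearly an
  equality on the whole cone that they span: lengthening the shorter of two summands raises the
  norm of the sum by at most the length that is added.
\<close>

lemma norm_add_scaleR_ge:
  fixes u x :: "'a::real_normed_vector"
  assumes u: "norm u \<le> 1" and x: "norm x \<le> 1" and ux: "norm (u + x) \<ge> 2 - e"
    and t: "0 \<le> t" and e: "0 \<le> e"
  shows "norm (u + t *\<^sub>R x) \<ge> 1 + t - (1 + t) * e"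
proof (cases "t \<le> 1")
  case True
  have "norm (u + x) \<le> norm (u + t *\<^sub>R x) + norm ((1 - t) *\<^sub>R x)"
    by (rule order_trans[OF _ norm_triangle_ineq]) (simp add: algebra_simps)
  also have "norm ((1 - t) *\<^sub>R x) \<le> 1 - t"
    using True x by (simp add: mult_left_le)
  finally have "norm (u + t *\<^sub>R x) \<ge> 1 + t - e"
    using ux by simp
  moreover have "e \<le> (1 + t) * e"
    using t e by (simp add: algebra_simps)
  ultimately show ?thesis
    by linarith
next
  case False
  have "t * norm (u + x) = norm (t *\<^sub>R (u + x))"
    using t by simp
  also have "\<dots> \<le> norm (u + t *\<^sub>R x) + norm ((t - 1) *\<^sub>R u)"
    by (rule order_trans[OF _ norm_triangle_ineq]) (simp add: algebra_simps)
  also have "norm ((t - 1) *\<^sub>R u) \<le> t - 1"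
    using False u by (simp add: mult_left_le)
  finally have "norm (u + t *\<^sub>R x) \<ge> t * norm (u + x) - (t - 1)"
    by simp
  moreover have "t * norm (u + x) \<ge> t * (2 - e)"
    using t ux by (intro mult_left_mono)
  ultimately show ?thesis
    using e by (simp add: algebra_simps)
qed

lemma (in banach_space_over) slices_imp_daugavet_unit:
  assumes w: "w \<in> dual_space smul" and x: "norm x = 1"
    and slices: "\<And>e. e > 0 \<Longrightarrow> \<exists>u t. norm u \<le> 1 \<and> w u = of_real t \<and> t \<ge> onorm w - e \<and>
      norm (u + x) \<ge> 2 - e"
  shows "onorm (\<lambda>z. z + rank_one smul w x z) = 1 + onorm w"
proof (rule antisym)
  note rank1 = bounded_linear_rank_one[OF w, of x]
  have x0: "x \<noteq> 0"
    using x by auto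
  show "onorm (\<lambda>z. z + rank_one smul w x z) \<le> 1 + onorm w"
    using onorm_triangle[OF bounded_linear_ident rank1]
    by (simp add: onorm_identity[OF x0] onorm_rank_one[OF w] x)
  note N = onorm_pos_le[OF dual_spaceD(1)[OF w]]
  let ?A = "onorm (\<lambda>z. z + rank_one smul w x z)"
  have bl: "bounded_linear (\<lambda>z. z + rank_one smul w x z)"
    by (intro bounded_linear_add bounded_linear_ident rank1)
  have "1 + onorm w \<le> ?A + d" if d: "d > 0" for d
  proof -
    define e where "e = d / (3 + onorm w)"
    have e: "e > 0" "(3 + onorm w) * e = d"
      using d N by (auto simp: e_def)
    obtain u t where u: "norm u \<le> 1" "w u = of_real t" "t \<ge> onorm w - e" "norm (u + x) \<ge> 2 - e"
      using slices[OF e(1)] by blast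
    \<comment> \<open>The value \<open>t\<close> may be negative when \<open>\<parallel>w\<parallel> < e\<close>, so \<open>\<parallel>w\<parallel>\<close> takes its place.\<close>
    have "1 + onorm w - (1 + onorm w) * e \<le> norm (u + onorm w *\<^sub>R x)"
      using u e x N by (intro norm_add_scaleR_ge) auto
    also have "\<dots> \<le> norm (u + t *\<^sub>R x) + norm ((onorm w - t) *\<^sub>R x)"
      by (rule order_trans[OF _ norm_triangle_ineq]) (simp add: algebra_simps)
    also have "norm ((onorm w - t) *\<^sub>R x) \<le> e"
    proof -
      have "\<bar>t\<bar> \<le> onorm w * norm u"
        using onorm[OF dual_spaceD(1)[OF w], of u] u(2) by simp
      also have "\<dots> \<le> onorm w"
        using u(1) N by (simp add: mult_left_le)
      finally show ?thesis
        using u(3) x by simp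
    qed
    also have "norm (u + t *\<^sub>R x) \<le> ?A"
    proof -
      have "norm (u + t *\<^sub>R x) \<le> ?A * norm u"
        using onorm[OF bl, of u] by (simp add: rank_one_def u(2) scale_of_real)
      also have "\<dots> \<le> ?A"
        using u(1) onorm_pos_le[OF bl] by (simp add: mult_left_le)
      finally show ?thesis .
    qed
    finally show ?thesis
      using e by (simp add: algebra_simps)
  qed
  then show "1 + onorm w \<le> ?A"
    by (rule field_le_epsilon)
qed

text \<open>
  Unit vectors suffice because \<open>w \<otimes> x = (\<parallel>x\<parallel> w) \<otimes> (x / \<parallel>x\<parallel>)\<close>, and \<open>\<parallel>x\<parallel> w\<close> is again in \<open>W\<close>.
\<close>

lemma (in banach_space_over) slices_imp_daugavet_wrt:
  assumes W: "dual_subspace smul W" and slices: "daugavet_slices W"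
    and nontrivial: "(x0::'a) \<noteq> 0"
  shows "daugavet_wrt smul W"
  unfolding daugavet_wrt_def
proof (intro allI ballI)
  fix x w
  assume w: "w \<in> W"
  note wd = dual_subspaceD(2)[OF W w]
  show "onorm (\<lambda>z. z + rank_one smul w x z) = 1 + onorm (rank_one smul w x)"
  proof (cases "x = 0")
    case True
    then have "rank_one smul w x = (\<lambda>z. 0)"
      by (simp add: rank_one_def fun_eq_iff)
    then show ?thesis
      by (simp add: onorm_identity[OF nontrivial] onorm_zero)
  next
    case False
    define v where "v = (\<lambda>z. of_real (norm x) * w z)"
    define y where "y = x /\<^sub>R norm x"
    have v: "v \<in> W"
      unfolding v_def by (rule dual_subspaceD(4)[OF W w])
    note vd = dual_subspaceD(2)[OF W v]
    have y: "norm y = 1"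
      using False by (simp add: y_def)
    have "smul (v z) y = smul (w z) x" for z
    proof -
      have "smul (v z) y = smul (w z) (smul (of_real (norm x)) y)"
        by (simp add: v_def mult.commute)
      also have "smul (of_real (norm x)) y = x"
        using False by (simp add: scale_of_real y_def)
      finally show ?thesis .
    qed
    then have eq: "rank_one smul w x = rank_one smul v y"
      by (simp add: rank_one_def)
    have "onorm (\<lambda>z. z + rank_one smul v y z) = 1 + onorm v"
      using slices v y by (intro slices_imp_daugavet_unit[OF vd y]) (auto simp: daugavet_slices_def)
    then show ?thesis
      by (simp add: eq onorm_rank_one[OF vd] y)
  qed
qed

lemma (in banach_space_over) daugavet_wrt_imp_nontrivial:
  assumes W: "dual_subspace smul W" and D: "daugavet_wrt smul W"
  shows "\<exists>x::'a. x \<noteq> 0"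
proof (rule ccontr)
  assume "\<not> ?thesis"
  then have trivial: "\<forall>x::'a. x = 0"
    by simp
  have "onorm (\<lambda>z. z + rank_one smul (\<lambda>x. 0) 0 z) = 1 + onorm (rank_one smul (\<lambda>x. 0) 0)"
    using D dual_subspaceD(1)[OF W] by (simp add: daugavet_wrt_def)
  then have "onorm (\<lambda>z::'a. z) = 1"
    by (simp add: rank_one_def onorm_zero)
  then show False
    using onorm_trivial_domain[OF trivial bounded_linear_ident] by simp
qed

section \<open>Norming subspaces\<close>

text \<open>
  On a nonzero space the unit sphere of a norming subspace cannot be empty, since otherwise
  the supremum would be the same for all vectors.
\<close>

lemma norming_imp_sphere_nonempty:
  fixes W :: "('a::banach \<Rightarrow> 'k::real_or_complex) set"
  assumes "norming W" and "(x::'a) \<noteq> 0"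
  shows "\<exists>w\<in>W. onorm w = 1"
proof (rule ccontr)
  assume "\<not> ?thesis"
  then have empty: "{w \<in> W. onorm w = 1} = {}"
    by blast
  have "norm z = Sup {}" for z :: 'a
    using assms(1)[unfolded norming_def empty, rule_format, of z] by simp
  from this[of x] this[of 0] have "norm x = norm (0::'a)"
    by simp
  then show False
    using assms(2) by simp
qed

lemma norming_approx:
  assumes "norming W" and "v \<in> W" "onorm v = 1" and "e > 0"
  shows "\<exists>w\<in>W. onorm w = 1 \<and> norm (w x) > norm x - e"
proof -
  let ?S = "{w \<in> W. onorm w = 1}"
  have "(SUP w\<in>?S. norm (w x)) > norm x - e"
    using assms(1,4) by (simp add: norming_def)
  moreover have "(\<lambda>w. norm (w x)) ` ?S \<noteq> {}"
    using assms(2,3) by blast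
  ultimately obtain r where "r \<in> (\<lambda>w. norm (w x)) ` ?S" "norm x - e < r"
    by (meson less_cSupE)
  then show ?thesis
    by blast
qed

lemma normingI:
  assumes W: "dual_subspace smul W" and v: "v \<in> W" "onorm v = 1"
    and approx: "\<And>x e. e > 0 \<Longrightarrow> \<exists>w\<in>W. onorm w = 1 \<and> norm (w x) > norm x - e"
  shows "norming W"
  unfolding norming_def
proof
  fix x
  let ?S = "{w \<in> W. onorm w = 1}"
  have le: "norm (w x) \<le> norm x" if "w \<in> ?S" for w
    using onorm[OF dual_spaceD(1)[OF dual_subspaceD(2)[OF W]], of w x] that by simp
  show "(SUP w\<in>?S. norm (w x)) = norm x"
  proof (rule cSup_eq_non_empty)
    show "(\<lambda>w. norm (w x)) ` ?S \<noteq> {}"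
      using v by blast
    show "y \<le> norm x" if "y \<in> (\<lambda>w. norm (w x)) ` ?S" for y
      using that le by auto
    show "norm x \<le> y" if "\<And>z. z \<in> (\<lambda>w. norm (w x)) ` ?S \<Longrightarrow> z \<le> y" for y
    proof (rule field_le_epsilon)
      fix e :: real
      assume "e > 0"
      then obtain w where "w \<in> ?S" "norm (w x) > norm x - e"
        using approx by blast
      moreover have "norm (w x) \<le> y"
        using \<open>w \<in> ?S\<close> by (intro that) blast
      ultimately show "norm x \<le> y + e"
        by simp
    qed
  qed
qed

section \<open>The dual of the maximum sum\<close>

abbreviation fst_of :: "('a, 'b) max_sum \<Rightarrow> 'a" where "fst_of p \<equiv> fst (pair_of p)"
abbreviation snd_of :: "('a, 'b) max_sum \<Rightarrow> 'b" where "snd_of p \<equiv> snd (pair_of p)"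

definition sum_functional ::
    "('a \<Rightarrow> 'k) \<Rightarrow> ('b \<Rightarrow> 'k) \<Rightarrow> ('a, 'b) max_sum \<Rightarrow> 'k::plus" where
  "sum_functional f g = (\<lambda>p. f (fst_of p) + g (snd_of p))"

definition sum_dual ::
    "('a \<Rightarrow> 'k) set \<Rightarrow> ('b \<Rightarrow> 'k) set \<Rightarrow> (('a, 'b) max_sum \<Rightarrow> 'k::plus) set" where
  "sum_dual U V = {sum_functional f g | f g. f \<in> U \<and> g \<in> V}"

lemma sum_functional_of_pair [simp]: "sum_functional f g (of_pair (x, y)) = f x + g y"
  by (simp add: sum_functional_def of_pair_inverse)

lemma norm_of_pair:
  "norm (of_pair (x, y) :: ('a::real_normed_vector, 'b::real_normed_vector) max_sum) =
     max (norm x) (norm y)"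
  by (simp add: norm_max_sum.rep_eq of_pair_inverse)

lemma of_pair_plus:
  "of_pair (x, y) + of_pair (x', y') =
     (of_pair (x + x', y + y') :: ('a::real_normed_vector, 'b::real_normed_vector) max_sum)"
  by (simp add: plus_max_sum.rep_eq of_pair_inverse flip: pair_of_inject)

lemma max_sum_cases: obtains x y where "p = of_pair (x, y)"
  by (metis pair_of_inverse prod.collapse)

lemma bounded_linear_fst_of:
  "bounded_linear (fst_of :: ('a::real_normed_vector, 'b::real_normed_vector) max_sum \<Rightarrow> 'a)"
  by (rule bounded_linear_intro[of _ 1])
    (simp_all add: plus_max_sum.rep_eq scaleR_max_sum.rep_eq norm_max_sum.rep_eq)

lemma bounded_linear_snd_of:
  "bounded_linear (snd_of :: ('a::real_normed_vector, 'b::real_normed_vector) max_sum \<Rightarrow> 'b)"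
  by (rule bounded_linear_intro[of _ 1])
    (simp_all add: plus_max_sum.rep_eq scaleR_max_sum.rep_eq norm_max_sum.rep_eq)

lemma bounded_linear_sum_functional:
  assumes "bounded_linear f" "bounded_linear g"
  shows "bounded_linear (sum_functional f g)"
  unfolding sum_functional_def
  by (intro bounded_linear_add bounded_linear_compose[OF assms(1) bounded_linear_fst_of]
      bounded_linear_compose[OF assms(2) bounded_linear_snd_of])

lemma onorm_sum_functional_le:
  fixes f :: "'a::real_normed_vector \<Rightarrow> 'k::real_normed_vector"
    and g :: "'b::real_normed_vector \<Rightarrow> 'k"
  assumes f: "bounded_linear f" and g: "bounded_linear g"
  shows "onorm (sum_functional f g) \<le> onorm f + onorm g"
proof (rule onorm_bound)
  note pos = onorm_pos_le[OF f] onorm_pos_le[OF g]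
  then show "0 \<le> onorm f + onorm g"
    by simp
  fix p :: "('a, 'b) max_sum"
  obtain x y where p: "p = of_pair (x, y)"
    by (rule max_sum_cases)
  have "norm (f x + g y) \<le> onorm f * norm x + onorm g * norm y"
    by (intro norm_triangle_le add_mono onorm f g)
  also have "\<dots> \<le> onorm f * max (norm x) (norm y) + onorm g * max (norm x) (norm y)"
    by (intro add_mono mult_left_mono pos) auto
  finally show "norm (sum_functional f g p) \<le> (onorm f + onorm g) * norm p"
    by (simp add: p norm_of_pair distrib_right)
qed

lemma onorm_sum_functional_zero_right:
  assumes f: "bounded_linear (f :: 'a::real_normed_vector \<Rightarrow> 'k::real_normed_vector)"
  shows "onorm (sum_functional f (\<lambda>y::'b::real_normed_vector. 0)) = onorm f"
proof (rule antisym)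
  let ?w = "sum_functional f (\<lambda>y::'b. 0)"
  have w: "bounded_linear ?w"
    by (intro bounded_linear_sum_functional f bounded_linear_zero)
  show "onorm ?w \<le> onorm f"
    using onorm_sum_functional_le[OF f bounded_linear_zero] by (simp add: onorm_zero)
  have "norm (f x) \<le> onorm ?w * norm x" for x
    using onorm[OF w, of "of_pair (x, 0)"] by (simp add: norm_of_pair)
  then show "onorm f \<le> onorm ?w"
    by (intro onorm_bound onorm_pos_le[OF w])
qed

lemma onorm_sum_functional_zero_left:
  assumes g: "bounded_linear (g :: 'b::real_normed_vector \<Rightarrow> 'k::real_normed_vector)"
  shows "onorm (sum_functional (\<lambda>x::'a::real_normed_vector. 0) g) = onorm g"
proof (rule antisym)
  let ?w = "sum_functional (\<lambda>x::'a. 0) g"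
  have w: "bounded_linear ?w"
    by (intro bounded_linear_sum_functional g bounded_linear_zero)
  show "onorm ?w \<le> onorm g"
    using onorm_sum_functional_le[OF bounded_linear_zero g] by (simp add: onorm_zero)
  have "norm (g y) \<le> onorm ?w * norm y" for y
    using onorm[OF w, of "of_pair (0, y)"] by (simp add: norm_of_pair)
  then show "onorm g \<le> onorm ?w"
    by (intro onorm_bound onorm_pos_le[OF w])
qed

lemma dual_subspace_sum_dual:
  fixes sX :: "'k::real_or_complex \<Rightarrow> 'a::banach \<Rightarrow> 'a" and sY :: "'k \<Rightarrow> 'b::banach \<Rightarrow> 'b"
  assumes U: "dual_subspace sX U" and V: "dual_subspace sY V"
  shows "dual_subspace (max_sum_scale sX sY) (sum_dual U V)"
  unfolding dual_subspace_def
proof (intro conjI subsetI ballI allI)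
  show "w \<in> dual_space (max_sum_scale sX sY)" if w_in: "w \<in> sum_dual U V" for w
  proof -
    obtain f g where w: "w = sum_functional f g" and fg: "f \<in> U" "g \<in> V"
      using w_in by (auto simp: sum_dual_def)
    note f = dual_spaceD[OF dual_subspaceD(2)[OF U fg(1)]]
    note g = dual_spaceD[OF dual_subspaceD(2)[OF V fg(2)]]
    show ?thesis
      using bounded_linear_sum_functional[OF f(1) g(1)]
      by (simp add: w dual_space_def sum_functional_def max_sum_scale.rep_eq f(2) g(2) distrib_left)
  qed
  have "(\<lambda>x. 0) = sum_functional (\<lambda>x::'a. 0::'k) (\<lambda>y::'b. 0)"
    by (simp add: sum_functional_def)
  then show "(\<lambda>x. 0) \<in> sum_dual U V"
    using dual_subspaceD(1)[OF U] dual_subspaceD(1)[OF V] by (auto simp: sum_dual_def)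
  show "(\<lambda>x. w x + w' x) \<in> sum_dual U V" if ww': "w \<in> sum_dual U V" "w' \<in> sum_dual U V" for w w'
  proof -
    obtain f g f' g' where w: "w = sum_functional f g" "w' = sum_functional f' g'"
      and fg: "f \<in> U" "g \<in> V" "f' \<in> U" "g' \<in> V"
      using ww' unfolding sum_dual_def by blast
    have "(\<lambda>x. w x + w' x) = sum_functional (\<lambda>x. f x + f' x) (\<lambda>y. g y + g' y)"
      by (simp add: w sum_functional_def algebra_simps)
    then show ?thesis
      using dual_subspaceD(3)[OF U fg(1,3)] dual_subspaceD(3)[OF V fg(2,4)]
      by (auto simp: sum_dual_def)
  qed
  show "(\<lambda>x. c * w x) \<in> sum_dual U V" if w_in: "w \<in> sum_dual U V" for c w
  proof -
    obtain f g where w: "w = sum_functional f g" and fg: "f \<in> U" "g \<in> V"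
      using w_in by (auto simp: sum_dual_def)
    have "(\<lambda>x. c * w x) = sum_functional (\<lambda>x. c * f x) (\<lambda>y. c * g y)"
      by (simp add: w sum_functional_def algebra_simps)
    then show ?thesis
      using dual_subspaceD(4)[OF U fg(1)] dual_subspaceD(4)[OF V fg(2)]
      by (auto simp: sum_dual_def)
  qed
qed

lemma norming_sum_dual:
  fixes sX :: "'k::real_or_complex \<Rightarrow> 'a::banach \<Rightarrow> 'a" and sY :: "'k \<Rightarrow> 'b::banach \<Rightarrow> 'b"
  assumes U: "dual_subspace sX U" and V: "dual_subspace sY V"
    and nU: "norming U" and nV: "norming V"
    and f0: "f0 \<in> U" "onorm f0 = 1" and g0: "g0 \<in> V" "onorm g0 = 1"
  shows "norming (sum_dual U V)"
proof -
  have left: "sum_functional f (\<lambda>y. 0) \<in> sum_dual U V \<and> onorm (sum_functional f (\<lambda>y::'b. 0)) = 1"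
    if "f \<in> U" "onorm f = 1" for f
    using that dual_subspaceD(1)[OF V]
      onorm_sum_functional_zero_right[OF dual_spaceD(1)[OF dual_subspaceD(2)[OF U that(1)]]]
    by (auto simp: sum_dual_def)
  have right: "sum_functional (\<lambda>x. 0) g \<in> sum_dual U V \<and> onorm (sum_functional (\<lambda>x::'a. 0) g) = 1"
    if "g \<in> V" "onorm g = 1" for g
    using that dual_subspaceD(1)[OF U]
      onorm_sum_functional_zero_left[OF dual_spaceD(1)[OF dual_subspaceD(2)[OF V that(1)]]]
    by (auto simp: sum_dual_def)
  show ?thesis
  proof (rule normingI[OF dual_subspace_sum_dual[OF U V]])
    show "sum_functional f0 (\<lambda>y. 0) \<in> sum_dual U V" "onorm (sum_functional f0 (\<lambda>y::'b. 0)) = 1"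
      using left[OF f0] by auto
    fix p :: "('a, 'b) max_sum" and e :: real
    assume e: "e > 0"
    obtain x y where p: "p = of_pair (x, y)"
      by (rule max_sum_cases)
    show "\<exists>w\<in>sum_dual U V. onorm w = 1 \<and> norm (w p) > norm p - e"
    proof (cases "norm x \<ge> norm y")
      case True
      obtain f where f: "f \<in> U" "onorm f = 1" "norm (f x) > norm x - e"
        using norming_approx[OF nU f0 e] by blast
      then show ?thesis
        using True left[OF f(1,2)]
        by (intro bexI[of _ "sum_functional f (\<lambda>y. 0)"]) (auto simp: p norm_of_pair)
    next
      case False
      obtain g where g: "g \<in> V" "onorm g = 1" "norm (g y) > norm y - e"
        using norming_approx[OF nV g0 e] by blast
      then show ?thesis
        using False right[OF g(1,2)]
        by (intro bexI[of _ "sum_functional (\<lambda>x. 0) g"]) (auto simp: p norm_of_pair)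
    qed
  qed
qed

section \<open>The Daugavet property of the maximum sum\<close>

text \<open>
  A unit vector of the sum has a coordinate of norm 1. The slice condition is applied in that
  coordinate, and the other one only has to nearly attain the norm of its functional.
\<close>

lemma daugavet_slices_sum_dual:
  fixes sX :: "'k::real_or_complex \<Rightarrow> 'a::banach \<Rightarrow> 'a" and sY :: "'k \<Rightarrow> 'b::banach \<Rightarrow> 'b"
  assumes X: "banach_space_over sX" and Y: "banach_space_over sY"
    and U: "dual_subspace sX U" and V: "dual_subspace sY V"
    and sU: "daugavet_slices U" and sV: "daugavet_slices V"
  shows "daugavet_slices (sum_dual U V)"
  unfolding daugavet_slices_def
proof (intro ballI allI impI)
  fix w and p :: "('a, 'b) max_sum" and e :: real
  assume "w \<in> sum_dual U V" and p1: "norm p = 1" and e: "e > 0"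
  then obtain f g where w: "w = sum_functional f g" and fg: "f \<in> U" "g \<in> V"
    by (auto simp: sum_dual_def)
  note f = dual_subspaceD(2)[OF U fg(1)] and g = dual_subspaceD(2)[OF V fg(2)]
  obtain x y where p: "p = of_pair (x, y)"
    by (rule max_sum_cases)
  have e2: "e / 2 > 0"
    using e by simp
  have "\<exists>u s v t. norm u \<le> 1 \<and> f u = of_real s \<and> s \<ge> onorm f - e / 2 \<and>
      norm v \<le> 1 \<and> g v = of_real t \<and> t \<ge> onorm g - e / 2 \<and>
      max (norm (u + x)) (norm (v + y)) \<ge> 2 - e / 2"
  proof (cases "norm x = 1")
    case True
    obtain u s where "norm u \<le> 1" "f u = of_real s" "s \<ge> onorm f - e / 2" "norm (u + x) \<ge> 2 - e / 2"
      using sU fg(1) True e2 unfolding daugavet_slices_def by meson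
    moreover obtain v t where "norm v \<le> 1" "g v = of_real t" "t \<ge> onorm g - e / 2"
      using banach_space_over.slice_nonempty[OF Y g e2] by blast
    ultimately show ?thesis
      by (meson max.coboundedI1)
  next
    case False
    then have "norm y = 1"
      using p1 by (simp add: p norm_of_pair max_def split: if_splits)
    then obtain v t
      where "norm v \<le> 1" "g v = of_real t" "t \<ge> onorm g - e / 2" "norm (v + y) \<ge> 2 - e / 2"
      using sV fg(2) e2 unfolding daugavet_slices_def by meson
    moreover obtain u s where "norm u \<le> 1" "f u = of_real s" "s \<ge> onorm f - e / 2"
      using banach_space_over.slice_nonempty[OF X f e2] by blast
    ultimately show ?thesis
      by (meson max.coboundedI2)
  qed
  then obtain u s v t where u: "norm u \<le> 1" "f u = of_real s" "s \<ge> onorm f - e / 2"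
    and v: "norm v \<le> 1" "g v = of_real t" "t \<ge> onorm g - e / 2"
    and far: "max (norm (u + x)) (norm (v + y)) \<ge> 2 - e / 2"
    by blast
  show "\<exists>q r. norm q \<le> 1 \<and> w q = of_real r \<and> r \<ge> onorm w - e \<and> norm (q + p) \<ge> 2 - e"
  proof (intro exI conjI)
    show "norm (of_pair (u, v)) \<le> 1"
      using u v by (simp add: norm_of_pair)
    show "w (of_pair (u, v)) = of_real (s + t)"
      by (simp add: w u v)
    show "s + t \<ge> onorm w - e"
      using onorm_sum_functional_le[OF dual_spaceD(1)[OF f] dual_spaceD(1)[OF g]] u(3) v(3)
      by (simp add: w)
    show "norm (of_pair (u, v) + p) \<ge> 2 - e"
      using far e unfolding p of_pair_plus norm_of_pair by linarith
  qed
qed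

theorem proposition2p1:
  fixes scaleX :: "'k::real_or_complex \<Rightarrow> 'a::banach \<Rightarrow> 'a"
    and scaleY :: "'k \<Rightarrow> 'b::banach \<Rightarrow> 'b"
  assumes "almost_daugavet scaleX" and "almost_daugavet scaleY"
    and "separable_space (euclidean :: 'a topology)"
    and "separable_space (euclidean :: 'b topology)"
  shows "almost_daugavet (max_sum_scale scaleX scaleY)"
proof -
  obtain U where X: "banach_space_over scaleX"
    and U: "dual_subspace scaleX U" "norming U" "daugavet_wrt scaleX U"
    using assms(1) by (auto simp: almost_daugavet_def)
  obtain V where Y: "banach_space_over scaleY"
    and V: "dual_subspace scaleY V" "norming V" "daugavet_wrt scaleY V"
    using assms(2) by (auto simp: almost_daugavet_def)
  obtain x :: 'a where x: "x \<noteq> 0"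
    using banach_space_over.daugavet_wrt_imp_nontrivial[OF X U(1,3)] by blast
  obtain y :: 'b where y: "y \<noteq> 0"
    using banach_space_over.daugavet_wrt_imp_nontrivial[OF Y V(1,3)] by blast
  obtain f where f: "f \<in> U" "onorm f = 1"
    using norming_imp_sphere_nonempty[OF U(2) x] by blast
  obtain g where g: "g \<in> V" "onorm g = 1"
    using norming_imp_sphere_nonempty[OF V(2) y] by blast
  let ?W = "sum_dual U V" and ?s = "max_sum_scale scaleX scaleY"
  note XY = banach_space_over_max_sum[OF X Y]
  have W: "dual_subspace ?s ?W"
    by (rule dual_subspace_sum_dual[OF U(1) V(1)])
  have "daugavet_slices ?W"
    using banach_space_over.daugavet_wrt_imp_slices[OF X U(1,3) f]
      banach_space_over.daugavet_wrt_imp_slices[OF Y V(1,3) g]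
    by (rule daugavet_slices_sum_dual[OF X Y U(1) V(1)])
  moreover have "(of_pair (x, y) :: ('a, 'b) max_sum) \<noteq> 0"
    using x norm_of_pair[of x y] by (metis max.cobounded1 norm_le_zero_iff norm_zero)
  ultimately have "daugavet_wrt ?s ?W"
    by (rule banach_space_over.slices_imp_daugavet_wrt[OF XY W])
  moreover have "norming ?W"
    by (rule norming_sum_dual[OF U(1) V(1) U(2) V(2) f g])
  ultimately show ?thesis
    using XY W by (auto simp: almost_daugavet_def)
qed

end
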